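(* The optimal smooth DC curvature dimension satisfies $$d^\star(f;X)=\min_{B\in\mathcal{B}(f;X)}\operatorname{rank} B .$$ In particular, an optimal effective curvature dimension is attained by a quadratic first component: there is $B\in\mathcal{B}(f;X)$ such that, with $g_B(x)=\tfrac12 x^\top Bx$ and $h_B=g_B-f$, one has $(g_B,h_B)\in\mathcal{D}^2(f;X)$ and $d_X(g_B)=d^\star(f;X)$.
   Context: $X\subset\mathbb{R}^n$ is compact and full dimensional (its affine hull is $\mathbb{R}^n$), $\widehat X=\operatorname{conv}X$, and $f$ is a real-valued $C^2$ function on an open neighborhood of $\widehat X$. $\succeq$ denotes the Loewner order on symmetric matrices. $\mathcal{D}^2(f;X)$ is the set of pairs $(g,h)$ of functions that are $C^2$ on a neighborhood of $\widehat X$, satisfy $f=g-h$ there, and are convex on $\widehat X$ (equivalently $\nabla^2 g(z)\succeq0$ and $\nabla^2h(z)\succeq0$ for all $z\in\widehat X$). For a $C^2$ convex $g$: $V_X(g)=\operatorname{span}\bigl(\bigcup_{z\in\widehat X}\operatorname{range}\nabla^2g(z)\bigr)$ and $d_X(g)=\dim V_X(g)$. The optimal dimension is $d^\star(f;X)=\min_{(g,h)\in\mathcal{D}^2(f;X)}d_X(g)$ (the set $\mathcal{D}^2(f;X)$ is nonempty). $\mathcal{B}(f;X)=\{B\in\mathbb{R}^{n\times n}\text{ symmetric positive semidefinite}: B-\nabla^2f(z)\succeq0\text{ for every }z\in\widehat X\}$. *)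

theory Defs
  imports "HOL-Analysis.Analysis"
begin

definition grad :: "(real^'n \<Rightarrow> real) \<Rightarrow> real^'n \<Rightarrow> real^'n" where
  "grad f x = (\<chi> i. frechet_derivative f (at x) (axis i 1))"

definition hessian :: "(real^'n \<Rightarrow> real) \<Rightarrow> real^'n \<Rightarrow> real^'n^'n" where
  "hessian f x = jacobian (grad f) (at x)"

definition C2_on :: "(real^'n \<Rightarrow> real) \<Rightarrow> (real^'n) set \<Rightarrow> bool" where
  "C2_on f U \<longleftrightarrow> open U \<and> f differentiable_on U \<and> grad f differentiable_on U
     \<and> continuous_on U (hessian f)"

definition psd :: "real^'n^'n \<Rightarrow> bool" where
  "psd A \<longleftrightarrow> transpose A = A \<and> (\<forall>v. 0 \<le> v \<bullet> (A *v v))"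

definition loewner_ge :: "real^'n^'n \<Rightarrow> real^'n^'n \<Rightarrow> bool"  (infix \<open>\<succeq>\<close> 50) where
  "A \<succeq> B \<longleftrightarrow> psd (A - B)"

(* Functions are total in HOL; only their values near the convex hull of X matter.  The single
   open set U is no restriction: intersect the neighbourhoods belonging to g, h and f = g - h. *)
definition dc2 :: "(real^'n \<Rightarrow> real) \<Rightarrow> (real^'n) set
    \<Rightarrow> ((real^'n \<Rightarrow> real) \<times> (real^'n \<Rightarrow> real)) set" where
  "dc2 f X = {(g, h).
     (\<exists>U. open U \<and> convex hull X \<subseteq> U \<and> C2_on g U \<and> C2_on h U \<and> (\<forall>x\<in>U. f x = g x - h x))
     \<and> convex_on (convex hull X) g \<and> convex_on (convex hull X) h}"

definition curv_space :: "(real^'n) set \<Rightarrow> (real^'n \<Rightarrow> real) \<Rightarrow> (real^'n) set" where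
  "curv_space X g = span (\<Union>z\<in>convex hull X. range ((*v) (hessian g z)))"

definition curv_dim :: "(real^'n) set \<Rightarrow> (real^'n \<Rightarrow> real) \<Rightarrow> nat" where
  "curv_dim X g = dim (curv_space X g)"

(* LEAST over nat is the minimum, as the set of attained dimensions is nonempty. *)
definition opt_curv_dim :: "(real^'n \<Rightarrow> real) \<Rightarrow> (real^'n) set \<Rightarrow> nat" where
  "opt_curv_dim f X = (LEAST d. \<exists>(g, h)\<in>dc2 f X. curv_dim X g = d)"

definition hess_majorants :: "(real^'n \<Rightarrow> real) \<Rightarrow> (real^'n) set \<Rightarrow> (real^'n^'n) set" where
  "hess_majorants f X = {B. psd B \<and> (\<forall>z\<in>convex hull X. B - hessian f z \<succeq> 0)}"

definition quad :: "real^'n^'n \<Rightarrow> real^'n \<Rightarrow> real" where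
  "quad B x = 1/2 * (x \<bullet> (B *v x))"

end

theory Submission
  imports Defs
begin

text \<open>
  The dimensions \<open>d\<^sub>X(g)\<close> attained over all decompositions are exactly the ranks attained over all
  Hessian majorants. Given a decomposition \<open>f = g - h\<close>, let \<open>P\<close> be the orthogonal projection onto
  the curvature space of \<open>g\<close> and \<open>c\<close> a bound for the norm of the Hessian of \<open>g\<close> on the compact set
  \<open>conv X\<close>. As the Hessian of \<open>g\<close> is symmetric with range in that space, it is dominated by
  \<open>c P\<close>, and so is the Hessian of \<open>f\<close>; the rank of \<open>c P\<close> is \<open>d\<^sub>X(g)\<close>. Conversely, a majorant \<open>B\<close>
  gives the decomposition with quadratic first component, whose Hessian is constantly \<open>B\<close>.
\<close>

section \<open>Gradient and Hessian calculus for C2 functions\<close>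

lemma C2_on_has_derivative:
  assumes "C2_on f U" "x \<in> U"
  shows "(f has_derivative (\<lambda>v. grad f x \<bullet> v)) (at x)"
    and "(grad f has_derivative (\<lambda>v. hessian f x *v v)) (at x)"
proof -
  have op: "open U" and "f differentiable_on U" "grad f differentiable_on U"
    using assms by (auto simp: C2_on_def)
  then have d: "f differentiable at x" "grad f differentiable at x"
    using assms(2) by (auto simp: differentiable_on_eq_differentiable_at)
  let ?D = "frechet_derivative f (at x)"
  have lin: "linear ?D"
    using d(1) by (simp add: linear_frechet_derivative)
  have "?D = (\<lambda>v. grad f x \<bullet> v)"
  proof
    fix v :: "real^'a"
    have "?D v = ?D (\<Sum>i\<in>UNIV. v $ i *\<^sub>R axis i 1)"
      by (simp add: basis_expansion flip: scalar_mult_eq_scaleR)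
    also have "\<dots> = (\<Sum>i\<in>UNIV. v $ i * ?D (axis i 1))"
      by (simp add: linear_sum[OF lin] linear_cmul[OF lin])
    also have "\<dots> = grad f x \<bullet> v"
      by (simp add: grad_def inner_vec_def mult.commute)
    finally show "?D v = grad f x \<bullet> v" .
  qed
  then show "(f has_derivative (\<lambda>v. grad f x \<bullet> v)) (at x)"
    using d(1) by (metis frechet_derivative_works)
  show "(grad f has_derivative (\<lambda>v. hessian f x *v v)) (at x)"
    using d(2) unfolding hessian_def by (simp add: jacobian_works)
qed

text \<open>Uniqueness of derivatives identifies any candidate fields \<open>G\<close> and
  \<open>A\<close> with \<open>grad f\<close> and \<open>hessian f\<close>, so differences and
  quadratics need only the usual differentiation rules.\<close>

lemma C2_onI:
  fixes f :: "real^'n \<Rightarrow> real"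
  assumes op: "open U"
    and f: "\<And>x. x \<in> U \<Longrightarrow> (f has_derivative (\<lambda>v. G x \<bullet> v)) (at x)"
    and G: "\<And>x. x \<in> U \<Longrightarrow> (G has_derivative (\<lambda>v. A x *v v)) (at x)"
    and A: "continuous_on U A"
  shows "C2_on f U" and "\<And>x. x \<in> U \<Longrightarrow> hessian f x = A x"
proof -
  have grad: "grad f x = G x" if "x \<in> U" for x
    using f[OF that] by (simp add: grad_def frechet_derivative_at[symmetric] vec_eq_iff inner_axis)
  \<comment> \<open>\<open>G\<close> and \<open>grad f\<close> are known to agree on
    \<open>U\<close> only; its openness lets the derivative pass from one to the other.\<close>
  have gradD: "(grad f has_derivative (\<lambda>v. A x *v v)) (at x)" if "x \<in> U" for x
    by (rule has_derivative_transform_within_open[OF G[OF that] op that]) (simp add: grad)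
  show hess: "hessian f x = A x" if "x \<in> U" for x
    unfolding hessian_def jacobian_def frechet_derivative_at[OF gradD[OF that], symmetric]
    by simp
  have "continuous_on U (hessian f)"
    using A by (rule continuous_on_eq) (simp add: hess)
  then show "C2_on f U"
    unfolding C2_on_def
    using op f gradD by (auto simp: differentiable_on_eq_differentiable_at intro: differentiableI)
qed

text \<open>The function \<open>h\<close> is constrained on \<open>S\<close> alone because a
  decomposition \<open>f = g - h\<close> is known only near the hull; elsewhere \<open>f\<close> is
  arbitrary.\<close>

lemma C2_on_diff:
  assumes f: "C2_on f U" and g: "C2_on g U" and op: "open S" "S \<subseteq> U"
    and eq: "\<And>x. x \<in> S \<Longrightarrow> h x = f x - g x"
  shows "C2_on h S" and "\<And>x. x \<in> S \<Longrightarrow> hessian h x = hessian f x - hessian g x"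
proof -
  have 1: "(h has_derivative (\<lambda>v. (grad f x - grad g x) \<bullet> v)) (at x)" if "x \<in> S" for x
  proof -
    have "((\<lambda>x. f x - g x) has_derivative (\<lambda>v. (grad f x - grad g x) \<bullet> v)) (at x)"
      using C2_on_has_derivative(1)[OF f, of x] C2_on_has_derivative(1)[OF g, of x] that op
      by (auto intro!: derivative_eq_intros simp: inner_diff_left)
    then show ?thesis
      by (rule has_derivative_transform_within_open[OF _ op(1) that]) (simp add: eq)
  qed
  have 2: "((\<lambda>x. grad f x - grad g x) has_derivative (\<lambda>v. (hessian f x - hessian g x) *v v)) (at x)"
    if "x \<in> S" for x
    using C2_on_has_derivative(2)[OF f, of x] C2_on_has_derivative(2)[OF g, of x] that op
    by (auto intro!: derivative_eq_intros simp: matrix_vector_mult_diff_rdistrib)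
  have 3: "continuous_on S (\<lambda>x. hessian f x - hessian g x)"
    using f g op by (auto simp: C2_on_def intro!: continuous_intros elim: continuous_on_subset)
  show "C2_on h S" and "\<And>x. x \<in> S \<Longrightarrow> hessian h x = hessian f x - hessian g x"
    using C2_onI[OF op(1) 1 2 3] by blast+
qed

lemma inner_matrix_symmetric:
  fixes A :: "real^'n^'n"
  assumes "transpose A = A"
  shows "x \<bullet> (A *v y) = (A *v x) \<bullet> y"
  by (metis assms dot_lmul_matrix transpose_matrix_vector)

lemma transpose_eq_selfI:
  fixes A :: "real^'n^'n"
  assumes "\<And>x y. x \<bullet> (A *v y) = (A *v x) \<bullet> y"
  shows "transpose A = A"
proof -
  have "A $ i $ j = A $ j $ i" for i j
    using assms[of "axis i 1" "axis j 1"]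
    by (simp add: inner_axis' inner_axis column_def matrix_vector_mul_component)
  then show ?thesis
    by (simp add: transpose_def vec_eq_iff)
qed

lemma C2_on_quad:
  assumes "transpose B = B"
  shows "C2_on (quad B) UNIV" and "hessian (quad B) x = B"
proof -
  have 1: "(quad B has_derivative (\<lambda>v. (B *v x) \<bullet> v)) (at x)" for x
  proof -
    have B: "((*v) B has_derivative (*v) B) (at x)"
      by (rule bounded_linear_imp_has_derivative[OF matrix_vector_mul_bounded_linear])
    have "((\<lambda>x. 1/2 * (x \<bullet> (B *v x))) has_derivative
        (\<lambda>v. 1/2 * (x \<bullet> (B *v v) + v \<bullet> (B *v x)))) (at x)"
      by (rule has_derivative_mult_right[OF has_derivative_inner[OF has_derivative_ident B]])
    \<comment> \<open>By symmetry of \<open>B\<close> the two terms of the product rule coincide,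
      and the factor 1/2 absorbs the doubling.\<close>
    moreover have "1/2 * (x \<bullet> (B *v v) + v \<bullet> (B *v x)) = (B *v x) \<bullet> v" for v
      using inner_matrix_symmetric[OF assms, of x v] by (simp add: inner_commute[of v])
    ultimately show ?thesis
      unfolding quad_def[abs_def] by simp
  qed
  have 2: "((\<lambda>x. B *v x) has_derivative (\<lambda>v. B *v v)) (at x)" for x
    by (rule bounded_linear_imp_has_derivative[OF matrix_vector_mul_bounded_linear])
  show "C2_on (quad B) UNIV" "hessian (quad B) x = B"
    using C2_onI[OF open_UNIV 1 2 continuous_on_const] by auto
qed

section \<open>Second differences and symmetry of the Hessian\<close>

lemma C2_on_line_derivatives:
  assumes "C2_on f U" "a + t *\<^sub>R u \<in> U"
  shows "((\<lambda>t. f (a + t *\<^sub>R u)) has_real_derivative grad f (a + t *\<^sub>R u) \<bullet> u) (at t)"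
    and "((\<lambda>t. grad f (a + t *\<^sub>R u) \<bullet> w) has_real_derivative
            w \<bullet> (hessian f (a + t *\<^sub>R u) *v u)) (at t)"
proof -
  have l: "((\<lambda>t. a + t *\<^sub>R u) has_derivative (\<lambda>s. s *\<^sub>R u)) (at t)"
    by (auto intro!: derivative_eq_intros)
  show "((\<lambda>t. f (a + t *\<^sub>R u)) has_real_derivative grad f (a + t *\<^sub>R u) \<bullet> u) (at t)"
    using has_derivative_compose[OF l C2_on_has_derivative(1)[OF assms]]
    by (simp add: has_field_derivative_def mult_commute_abs)
  have "((\<lambda>t. grad f (a + t *\<^sub>R u) \<bullet> w) has_derivative
          (\<lambda>s. (hessian f (a + t *\<^sub>R u) *v (s *\<^sub>R u)) \<bullet> w)) (at t)"
    by (rule has_derivative_inner_left, rule has_derivative_compose[OF l C2_on_has_derivative(2)[OF assms]])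
  then show "((\<lambda>t. grad f (a + t *\<^sub>R u) \<bullet> w) has_real_derivative
            w \<bullet> (hessian f (a + t *\<^sub>R u) *v u)) (at t)"
    by (simp add: has_field_derivative_def mult_commute_abs matrix_vector_mult_scaleR inner_commute)
qed

text \<open>Applying the mean value theorem first along \<^term>\<open>u\<close> and then along \<^term>\<open>v\<close>
  treats the two directions asymmetrically although the difference is symmetric in them; this
  yields the symmetry of the Hessian, and with \<^term>\<open>u = v\<close> its positivity for convex \<^term>\<open>f\<close>.\<close>
lemma second_difference_mvt:
  assumes f: "C2_on f U" and "t > 0"
    and U: "\<And>r s. 0 \<le> r \<Longrightarrow> r \<le> t \<Longrightarrow> 0 \<le> s \<Longrightarrow> s \<le> t \<Longrightarrow> x + r *\<^sub>R u + s *\<^sub>R v \<in> U"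
  obtains r s where "0 < r" "r < t" "0 < s" "s < t"
    and "f (x + t *\<^sub>R u + t *\<^sub>R v) - f (x + t *\<^sub>R u) - f (x + t *\<^sub>R v) + f x
      = t\<^sup>2 * (u \<bullet> (hessian f (x + r *\<^sub>R u + s *\<^sub>R v) *v v))"
proof -
  define \<phi> where "\<phi> r = f ((x + t *\<^sub>R v) + r *\<^sub>R u) - f (x + r *\<^sub>R u)" for r
  have "(\<phi> has_real_derivative
      grad f ((x + t *\<^sub>R v) + r *\<^sub>R u) \<bullet> u - grad f (x + r *\<^sub>R u) \<bullet> u) (at r)"
    if "0 \<le> r" "r \<le> t" for r
    unfolding \<phi>_def using U[of r t] U[of r 0] that \<open>t > 0\<close>
    by (intro DERIV_diff C2_on_line_derivatives[OF f]) (auto simp: ac_simps)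
  from MVT2[OF \<open>t > 0\<close> this] obtain r where r: "0 < r" "r < t"
    and 1: "\<phi> t - \<phi> 0 = t * (grad f ((x + t *\<^sub>R v) + r *\<^sub>R u) \<bullet> u - grad f (x + r *\<^sub>R u) \<bullet> u)"
    by auto
  define \<psi> where "\<psi> s = grad f ((x + r *\<^sub>R u) + s *\<^sub>R v) \<bullet> u" for s
  have "(\<psi> has_real_derivative u \<bullet> (hessian f (x + r *\<^sub>R u + s *\<^sub>R v) *v v)) (at s)"
    if "0 \<le> s" "s \<le> t" for s
    unfolding \<psi>_def using U[of r s] that r by (intro C2_on_line_derivatives[OF f]) auto
  from MVT2[OF \<open>t > 0\<close> this] obtain s where s: "0 < s" "s < t"
    and 2: "\<psi> t - \<psi> 0 = t * (u \<bullet> (hessian f (x + r *\<^sub>R u + s *\<^sub>R v) *v v))"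
    by auto
  have "\<phi> t - \<phi> 0 = t * (\<psi> t - \<psi> 0)"
    unfolding 1 by (simp add: \<psi>_def ac_simps)
  then show thesis
    using that[OF r s] by (simp add: 2 \<phi>_def power2_eq_square ac_simps)
qed

text \<open>The mean value point is not explicit, but it lies in the parallelogram spanned by the
  two steps, which shrinks to \<open>x\<close>. Since every small \<open>t\<close> is admissible,
  two such representations can share one \<open>t\<close>.\<close>

lemma second_difference_near:
  assumes f: "C2_on f U" and "x \<in> U" "e > 0"
  obtains d where "d > 0" and
    "\<And>t. 0 < t \<Longrightarrow> t < d \<Longrightarrow> \<exists>p\<in>U \<inter> ball x e.
       f (x + t *\<^sub>R u + t *\<^sub>R v) - f (x + t *\<^sub>R u) - f (x + t *\<^sub>R v) + f x
         = t\<^sup>2 * (u \<bullet> (hessian f p *v v))"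
proof -
  have "open (U \<inter> ball x e)" "x \<in> U \<inter> ball x e"
    using f \<open>x \<in> U\<close> \<open>e > 0\<close> by (auto simp: C2_on_def)
  then obtain e' where e': "e' > 0" "ball x e' \<subseteq> U \<inter> ball x e"
    using open_contains_ball by blast
  \<comment> \<open>Points of the parallelogram are at distance at most
    \<open>t * (norm u + norm v)\<close> from \<open>x\<close>; the added 1 keeps the denominator
    positive when both directions vanish.\<close>
  let ?d = "e' / (norm u + norm v + 1)"
  have pos: "norm u + norm v + 1 > 0"
    by (smt (verit) norm_ge_zero)
  have near: "x + r *\<^sub>R u + s *\<^sub>R v \<in> U \<inter> ball x e"
    if "0 \<le> r" "r \<le> t" "0 \<le> s" "s \<le> t" "0 < t" "t < ?d" for r s t
  proof -
    have "dist x (x + r *\<^sub>R u + s *\<^sub>R v) = norm (r *\<^sub>R u + s *\<^sub>R v)"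
      by (metis add.assoc add_diff_cancel_left' dist_commute dist_norm)
    also have "\<dots> \<le> r * norm u + s * norm v"
      using norm_triangle_ineq[of "r *\<^sub>R u" "s *\<^sub>R v"] that by simp
    also have "\<dots> \<le> t * norm u + t * norm v"
      using that by (intro add_mono mult_right_mono) auto
    also have "\<dots> \<le> t * (norm u + norm v + 1)"
      using that by (simp add: algebra_simps)
    also have "\<dots> < e'"
      using that pos by (simp add: field_simps)
    finally show ?thesis
      using e' by auto
  qed
  show thesis
  proof (rule that)
    show "?d > 0"
      using e' pos by simp
    fix t assume t: "0 < t" "t < ?d"
    have U: "x + r *\<^sub>R u + s *\<^sub>R v \<in> U" if "0 \<le> r" "r \<le> t" "0 \<le> s" "s \<le> t" for r s
      using near[OF that t] by simp
    show "\<exists>p\<in>U \<inter> ball x e.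
       f (x + t *\<^sub>R u + t *\<^sub>R v) - f (x + t *\<^sub>R u) - f (x + t *\<^sub>R v) + f x
         = t\<^sup>2 * (u \<bullet> (hessian f p *v v))"
    proof (rule second_difference_mvt[OF f t(1) U])
      fix r s
      assume "0 < r" "r < t" "0 < s" "s < t"
        and *: "f (x + t *\<^sub>R u + t *\<^sub>R v) - f (x + t *\<^sub>R u) - f (x + t *\<^sub>R v) + f x
            = t\<^sup>2 * (u \<bullet> (hessian f (x + r *\<^sub>R u + s *\<^sub>R v) *v v))"
      then have "x + r *\<^sub>R u + s *\<^sub>R v \<in> U \<inter> ball x e"
        by (intro near[of r t s]) (use t in auto)
      with * show ?thesis
        by (rule bexI)
    qed
  qed
qed

lemma continuous_on_hessian_form:
  assumes "C2_on f U"
  shows "continuous_on U (\<lambda>z. u \<bullet> (hessian f z *v v))"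
  using assms unfolding C2_on_def inner_vec_def matrix_vector_mult_def
  by (auto intro!: continuous_intros)

lemma hessian_form_near:
  assumes f: "C2_on f U" and "x \<in> U" "e > 0"
  obtains d where "d > 0"
    "\<And>p. p \<in> U \<inter> ball x d \<Longrightarrow> \<bar>u \<bullet> (hessian f p *v v) - u \<bullet> (hessian f x *v v)\<bar> < e"
proof -
  from continuous_on_hessian_form[OF f, of u v] assms(2,3)
  obtain d where "d > 0" "\<forall>p\<in>U. dist p x < d \<longrightarrow>
      dist (u \<bullet> (hessian f p *v v)) (u \<bullet> (hessian f x *v v)) < e"
    unfolding continuous_on_iff by blast
  then show thesis
    using that by (auto simp: dist_real_def dist_commute)
qed

text \<open>Exchanging \<open>u\<close> and \<open>v\<close> leaves the second difference unchanged,
  so the two mixed forms agree at two possibly different points near \<open>x\<close>. Continuity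
  moves each to \<open>x\<close> at a cost below \<open>e / 2\<close>.\<close>

lemma hessian_symmetric:
  assumes f: "C2_on f U" and "x \<in> U"
  shows "transpose (hessian f x) = hessian f x"
proof (rule transpose_eq_selfI)
  fix u v :: "real^'a"
  have "\<bar>u \<bullet> (hessian f x *v v) - v \<bullet> (hessian f x *v u)\<bar> \<le> e" if "e > 0" for e
  proof -
    from \<open>e > 0\<close> have "e / 2 > 0" by simp
    obtain d1 where d1: "d1 > 0"
      "\<And>p. p \<in> U \<inter> ball x d1 \<Longrightarrow> \<bar>u \<bullet> (hessian f p *v v) - u \<bullet> (hessian f x *v v)\<bar> < e / 2"
      using hessian_form_near[OF assms \<open>e / 2 > 0\<close>] by blast
    obtain d2 where d2: "d2 > 0"
      "\<And>p. p \<in> U \<inter> ball x d2 \<Longrightarrow> \<bar>v \<bullet> (hessian f p *v u) - v \<bullet> (hessian f x *v u)\<bar> < e / 2"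
      using hessian_form_near[OF assms \<open>e / 2 > 0\<close>] by blast
    obtain t1 where t1: "t1 > 0" "\<And>t. 0 < t \<Longrightarrow> t < t1 \<Longrightarrow> \<exists>p\<in>U \<inter> ball x d1.
       f (x + t *\<^sub>R u + t *\<^sub>R v) - f (x + t *\<^sub>R u) - f (x + t *\<^sub>R v) + f x
         = t\<^sup>2 * (u \<bullet> (hessian f p *v v))"
      using second_difference_near[OF assms d1(1)] by blast
    obtain t2 where t2: "t2 > 0" "\<And>t. 0 < t \<Longrightarrow> t < t2 \<Longrightarrow> \<exists>p\<in>U \<inter> ball x d2.
       f (x + t *\<^sub>R v + t *\<^sub>R u) - f (x + t *\<^sub>R v) - f (x + t *\<^sub>R u) + f x
         = t\<^sup>2 * (v \<bullet> (hessian f p *v u))"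
      using second_difference_near[OF assms d2(1)] by blast
    \<comment> \<open>A single step size below both thresholds makes the two representations
      describe the same second difference.\<close>
    define t where "t = min t1 t2 / 2"
    have t: "0 < t" "t < t1" "t < t2"
      using t1 t2 by (auto simp: t_def)
    obtain p where p: "p \<in> U \<inter> ball x d1"
       "f (x + t *\<^sub>R u + t *\<^sub>R v) - f (x + t *\<^sub>R u) - f (x + t *\<^sub>R v) + f x
         = t\<^sup>2 * (u \<bullet> (hessian f p *v v))"
      using t1(2) t by blast
    obtain q where q: "q \<in> U \<inter> ball x d2"
       "f (x + t *\<^sub>R v + t *\<^sub>R u) - f (x + t *\<^sub>R v) - f (x + t *\<^sub>R u) + f x
         = t\<^sup>2 * (v \<bullet> (hessian f q *v u))"
      using t2(2) t by blast
    have "x + t *\<^sub>R v + t *\<^sub>R u = x + t *\<^sub>R u + t *\<^sub>R v"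
      by (simp add: ac_simps)
    then have "t\<^sup>2 * (u \<bullet> (hessian f p *v v)) = t\<^sup>2 * (v \<bullet> (hessian f q *v u))"
      using p(2) q(2) by (simp only:)
    then have "u \<bullet> (hessian f p *v v) = v \<bullet> (hessian f q *v u)"
      using t by simp
    then show ?thesis
      using d1(2)[OF p(1)] d2(2)[OF q(1)] by linarith
  qed
  then show "u \<bullet> (hessian f x *v v) = (hessian f x *v u) \<bullet> v"
    by (metis abs_le_zero_iff dense_ge eq_iff_diff_eq_0 inner_commute)
qed

section \<open>Convexity and positive semidefinite Hessians\<close>

text \<open>Convexity is available only inside \<open>K\<close>, so second differences are tested at
  interior points, where small steps stay in \<open>K\<close>. The remaining points of
  \<open>K\<close> are limits of interior ones, and the Hessian is continuous.\<close>

lemma convex_on_imp_hessian_psd: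
  assumes f: "C2_on f U" and K: "convex_on K f" "K \<subseteq> U" "interior K \<noteq> {}" and "x \<in> K"
  shows "psd (hessian f x)"
  unfolding psd_def
proof (intro conjI allI)
  show "transpose (hessian f x) = hessian f x"
    using hessian_symmetric[OF f] K(2) \<open>x \<in> K\<close> by blast
  fix v :: "real^'a"
  have near: "\<exists>p\<in>U \<inter> ball z d. 0 \<le> v \<bullet> (hessian f p *v v)" if z: "z \<in> interior K" and "d > 0" for z d
  proof -
    have "z \<in> U"
      using z K(2) interior_subset by blast
    then obtain t1 where t1: "t1 > 0" "\<And>t. 0 < t \<Longrightarrow> t < t1 \<Longrightarrow> \<exists>p\<in>U \<inter> ball z d.
       f (z + t *\<^sub>R v + t *\<^sub>R v) - f (z + t *\<^sub>R v) - f (z + t *\<^sub>R v) + f z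
         = t\<^sup>2 * (v \<bullet> (hessian f p *v v))"
      using second_difference_near[OF f _ \<open>d > 0\<close>] by blast
    obtain e where e: "e > 0" "ball z e \<subseteq> K"
      using z by (auto simp: mem_interior)
    have pos: "norm v + 1 > 0"
      by (smt (verit) norm_ge_zero)
    \<comment> \<open>The halving gives \<open>t < t1\<close> and also keeps the doubled step
      \<open>z + 2 t v\<close> inside the ball around \<open>z\<close>.\<close>
    define t where "t = min t1 (e / (norm v + 1)) / 2"
    have t: "0 < t" "t < t1" "2 * t \<le> e / (norm v + 1)"
      using t1(1) e(1) pos by (auto simp: t_def)
    have "2 * t * norm v < e"
      using t pos e by (simp add: field_simps)
    then have "z + t *\<^sub>R v + t *\<^sub>R v \<in> K"
      using e(2) t(1)
      by (auto simp: subset_iff dist_norm add.assoc norm_minus_commute simp flip: scaleR_left_distrib)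
    moreover have "z \<in> K"
      using z interior_subset by blast
    \<comment> \<open>Midpoint convexity between \<open>z\<close> and \<open>z + 2 t v\<close> is
      exactly nonnegativity of the second difference with both directions equal to
      \<open>v\<close>.\<close>
    ultimately have "f ((1 - 1/2) *\<^sub>R z + (1/2) *\<^sub>R (z + t *\<^sub>R v + t *\<^sub>R v))
        \<le> (1 - 1/2) * f z + (1/2) * f (z + t *\<^sub>R v + t *\<^sub>R v)"
      by (intro convex_onD[OF K(1)]) auto
    moreover have "(1 - 1/2) *\<^sub>R z + (1/2) *\<^sub>R (z + t *\<^sub>R v + t *\<^sub>R v) = z + t *\<^sub>R v"
      by (simp add: vec_eq_iff field_simps)
    ultimately have "0 \<le> f (z + t *\<^sub>R v + t *\<^sub>R v) - f (z + t *\<^sub>R v) - f (z + t *\<^sub>R v) + f z"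
      by simp
    moreover obtain p where "p\<in>U \<inter> ball z d"
       "f (z + t *\<^sub>R v + t *\<^sub>R v) - f (z + t *\<^sub>R v) - f (z + t *\<^sub>R v) + f z
         = t\<^sup>2 * (v \<bullet> (hessian f p *v v))"
      using t1(2) t by blast
    ultimately show ?thesis
      using t(1) by (auto simp: zero_le_mult_iff)
  qed
  have "- e \<le> v \<bullet> (hessian f x *v v)" if "e > 0" for e
  proof -
    have "x \<in> U"
      using \<open>x \<in> K\<close> K by blast
    then obtain d where d: "d > 0"
      "\<And>p. p \<in> U \<inter> ball x d \<Longrightarrow> \<bar>v \<bullet> (hessian f p *v v) - v \<bullet> (hessian f x *v v)\<bar> < e"
      using hessian_form_near[OF f _ \<open>e > 0\<close>] by blast
    \<comment> \<open>A convex set with nonempty interior lies in the closure of that interior. Half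
      of \<open>d\<close> is spent on reaching an interior \<open>z\<close>, the other half on the
      mean value point \<open>p\<close> near \<open>z\<close>.\<close>
    have "x \<in> closure (interior K)"
      using convex_closure_interior[of K] K convex_on_imp_convex \<open>x \<in> K\<close> closure_subset by blast
    then obtain z where z: "z \<in> interior K" "dist z x < d / 2"
      using d(1) by (meson closure_approachable half_gt_zero)
    obtain p where p: "p \<in> U \<inter> ball z (d / 2)" "0 \<le> v \<bullet> (hessian f p *v v)"
      using near[OF z(1), of "d / 2"] d(1) by auto
    have "dist x p < d"
      using p(1) z(2) dist_triangle[of x p z] by (simp add: dist_commute)
    then show ?thesis
      using d(2)[of p] p by auto
  qed
  then show "0 \<le> v \<bullet> (hessian f x *v v)"
    by (metis dense_ge neg_0_le_iff_le neg_le_iff_le minus_le_iff)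
qed

text \<open>On a segment the second derivative is the Hessian form in the direction of the segment.
  As \<open>K\<close> sits in the open set \<open>U\<close>, two-sided derivatives exist even at the
  endpoints.\<close>

lemma hessian_psd_imp_convex_on:
  assumes f: "C2_on f U" and K: "convex K" "K \<subseteq> U"
    and psd: "\<And>z. z \<in> K \<Longrightarrow> psd (hessian f z)"
  shows "convex_on K f"
proof (rule convex_onI)
  fix t :: real and x y :: "real^'a"
  assume t: "0 < t" "t < 1" and xy: "x \<in> K" "y \<in> K"
  let ?u = "y - x"
  define \<phi> where "\<phi> s = f (x + s *\<^sub>R ?u)" for s
  have seg: "x + s *\<^sub>R ?u \<in> K" if "s \<in> {0..1}" for s
  proof -
    have "(1 - s) *\<^sub>R x + s *\<^sub>R y \<in> K"
      using convexD_alt[OF K(1) xy] that by auto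
    then show ?thesis
      by (simp add: algebra_simps)
  qed
  have "convex_on {0..1} \<phi>"
  proof (rule f''_ge0_imp_convex)
    fix s :: real assume s: "s \<in> {0..1}"
    show "(\<phi> has_real_derivative grad f (x + s *\<^sub>R ?u) \<bullet> ?u) (at s)"
      unfolding \<phi>_def using seg[OF s] K(2) by (intro C2_on_line_derivatives[OF f]) auto
    show "((\<lambda>s. grad f (x + s *\<^sub>R ?u) \<bullet> ?u) has_real_derivative
        ?u \<bullet> (hessian f (x + s *\<^sub>R ?u) *v ?u)) (at s)"
      using seg[OF s] K(2) by (intro C2_on_line_derivatives[OF f]) auto
    show "0 \<le> ?u \<bullet> (hessian f (x + s *\<^sub>R ?u) *v ?u)"
      using psd[OF seg[OF s]] by (simp add: psd_def)
  qed simp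
  then have "\<phi> ((1 - t) *\<^sub>R 0 + t *\<^sub>R 1) \<le> (1 - t) * \<phi> 0 + t * \<phi> 1"
    using t by (intro convex_onD) auto
  moreover have "x + t *\<^sub>R ?u = (1 - t) *\<^sub>R x + t *\<^sub>R y"
    by (simp add: algebra_simps)
  ultimately show "f ((1 - t) *\<^sub>R x + t *\<^sub>R y) \<le> (1 - t) * f x + t * f y"
    by (simp add: \<phi>_def)
qed (rule K)

section \<open>Norm bounds, orthogonal projections and Loewner domination\<close>

text \<open>Cauchy-Schwarz in each row, with the norm of a row bounded by that of the matrix. The
  crude dimensional factor is harmless, since any finite bound will do.\<close>

lemma norm_matrix_vector_mult_le_card:
  fixes A :: "real^'n^'m"
  shows "norm (A *v x) \<le> CARD('m) * norm A * norm x"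
proof -
  have "norm (A *v x) \<le> (\<Sum>i\<in>UNIV. \<bar>(A *v x) $ i\<bar>)"
    by (rule norm_le_l1_cart)
  also have "\<dots> \<le> (\<Sum>i\<in>(UNIV::'m set). norm A * norm x)"
  proof (rule sum_mono)
    fix i
    have "\<bar>(A *v x) $ i\<bar> \<le> norm (A $ i) * norm x"
      by (simp add: matrix_vector_mul_component Cauchy_Schwarz_ineq2)
    also have "\<dots> \<le> norm A * norm x"
      by (intro mult_right_mono Finite_Cartesian_Product.norm_nth_le) simp
    finally show "\<bar>(A *v x) $ i\<bar> \<le> norm A * norm x" .
  qed
  finally show ?thesis
    by simp
qed

text \<open>The Hessian is continuous, hence bounded on \<open>K\<close>. Strict positivity of
  \<open>c\<close> is recorded because scaling a projection by \<open>c\<close> must preserve its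
  rank.\<close>

lemma hessian_bounded_on_compact:
  fixes f :: "real^'n \<Rightarrow> real"
  assumes f: "C2_on f U" and K: "compact K" "K \<subseteq> U"
  obtains c where "c > 0" "\<And>z v. z \<in> K \<Longrightarrow> norm (hessian f z *v v) \<le> c * norm v"
proof -
  have "compact (hessian f ` K)"
    using f K by (auto simp: C2_on_def intro: compact_continuous_image continuous_on_subset)
  then obtain b where b: "b > 0" "\<And>z. z \<in> K \<Longrightarrow> norm (hessian f z) \<le> b"
    by (metis compact_imp_bounded bounded_pos imageI)
  show thesis
  proof
    show "CARD('n) * b > 0"
      using b by simp
    fix z v assume "z \<in> K"
    have "norm (hessian f z *v v) \<le> CARD('n) * norm (hessian f z) * norm v"
      by (rule norm_matrix_vector_mult_le_card)
    also have "\<dots> \<le> CARD('n) * b * norm v"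
      using b \<open>z \<in> K\<close> by (intro mult_right_mono mult_left_mono) auto
    finally show "norm (hessian f z *v v) \<le> CARD('n) * b * norm v" .
  qed
qed

text \<open>The projection is the expansion in an orthonormal basis of \<open>V\<close>; symmetry is
  visible from that sum.\<close>

lemma orthogonal_projection_matrix:
  fixes V :: "(real^'n) set"
  assumes "subspace V"
  obtains P :: "real^'n^'n" where "transpose P = P" "range ((*v) P) = V" "\<And>x. x \<in> V \<Longrightarrow> P *v x = x"
proof -
  obtain B where B: "B \<subseteq> V" "pairwise orthogonal B" "\<And>x. x \<in> B \<Longrightarrow> norm x = 1" "independent B"
    "span B = V"
    using orthonormal_basis_subspace[OF assms] by metis
  have fin: "finite B"
    using B(4) independent_imp_finite by blast
  define p where "p x = (\<Sum>b\<in>B. (b \<bullet> x) *\<^sub>R b)" for x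
  have lin: "linear p"
    unfolding p_def
    by (auto intro!: linearI simp: inner_add_right scaleR_left_distrib sum.distrib scaleR_right.sum)
  have pv: "matrix p *v x = p x" for x
    using lin by simp
  have in_V: "p x \<in> V" for x
    unfolding p_def B(5)[symmetric] by (intro span_sum span_scale span_base)
  have id: "p x = x" if "x \<in> V" for x
    using that unfolding B(5)[symmetric]
  proof (induction rule: span_induct_alt)
    case base
    then show ?case by (simp add: p_def)
  next
    case (step c y z)
    \<comment> \<open>On a basis vector orthonormality leaves one term; linearity then carries the
      identity to the span.\<close>
    have "p y = (\<Sum>b\<in>B. if b = y then y else 0)"
      unfolding p_def
    proof (rule sum.cong)
      fix b assume "b \<in> B"
      then show "(b \<bullet> y) *\<^sub>R b = (if b = y then y else 0)"
        using B(2,3) step(1) by (auto simp: pairwise_def orthogonal_def norm_eq_1)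
    qed simp
    then have "p y = y"
      using step(1) fin by simp
    then show ?case
      using step by (simp add: linear_add[OF lin] linear_cmul[OF lin])
  qed
  show thesis
  proof
    show "transpose (matrix p) = matrix p"
    proof (rule transpose_eq_selfI)
      fix x y
      show "x \<bullet> (matrix p *v y) = (matrix p *v x) \<bullet> y"
        unfolding pv p_def by (simp add: inner_sum_left inner_sum_right inner_commute mult.commute)
    qed
    show "range ((*v) (matrix p)) = V"
    proof (intro equalityI subsetI)
      fix x
      show "x \<in> V" if "x \<in> range ((*v) (matrix p))"
        using that in_V by (auto simp: pv)
      show "x \<in> range ((*v) (matrix p))" if "x \<in> V"
        using id[OF that] by (metis pv rangeI)
    qed
    show "matrix p *v x = x" if "x \<in> V" for x
      using id[OF that] by (simp add: pv)
  qed
qed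

text \<open>The quadratic form of \<open>H\<close> sees only \<open>P *v v\<close>, so
  Cauchy-Schwarz bounds it by \<open>c\<close> times the squared norm of \<open>P *v v\<close>,
  which is the form of \<open>c *\<^sub>R P\<close>.\<close>

lemma psd_scaled_projection_diff:
  fixes P H :: "real^'n^'n"
  assumes P: "transpose P = P" "range ((*v) P) = V" "\<And>x. x \<in> V \<Longrightarrow> P *v x = x"
    and H: "transpose H = H" "range ((*v) H) \<subseteq> V" "\<And>x. norm (H *v x) \<le> c * norm x"
  shows "psd (c *\<^sub>R P - H)"
  unfolding psd_def
proof (intro conjI allI)
  show "transpose (c *\<^sub>R P - H) = c *\<^sub>R P - H"
    using P(1) H(1) by (simp add: transpose_def vec_eq_iff)
  fix v
  have PH: "P *v (H *v x) = H *v x" for x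
    using H(2) P(3) by blast
  have PP: "P *v (P *v x) = P *v x" for x
    using P by blast
  \<comment> \<open>\<open>P\<close> fixes the range of \<open>H\<close>, so it can be inserted
    before \<open>H\<close> and moved across by symmetry; symmetry of \<open>H\<close> allows the
    same in the other argument.\<close>
  have "v \<bullet> (H *v v) = (P *v v) \<bullet> (H *v v)"
    by (metis PH P(1) inner_matrix_symmetric)
  also have "\<dots> = (P *v v) \<bullet> (H *v (P *v v))"
    by (metis PH P(1) H(1) inner_matrix_symmetric)
  also have "\<dots> \<le> norm (P *v v) * norm (H *v (P *v v))"
    by (rule norm_cauchy_schwarz)
  also have "\<dots> \<le> norm (P *v v) * (c * norm (P *v v))"
    by (intro mult_left_mono H) simp
  also have "\<dots> = c * ((P *v v) \<bullet> (P *v v))"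
    by (simp add: power2_norm_eq_inner[symmetric] power2_eq_square)
  also have "\<dots> = v \<bullet> ((c *\<^sub>R P) *v v)"
    by (metis PP P(1) inner_matrix_symmetric inner_scaleR_right scaleR_matrix_vector_assoc)
  finally show "0 \<le> v \<bullet> ((c *\<^sub>R P - H) *v v)"
    by (simp add: matrix_vector_mult_diff_rdistrib inner_diff_right)
qed

lemma psd_add:
  assumes "psd A" "psd B"
  shows "psd (A + B)"
  using assms unfolding psd_def
  by (auto simp: transpose_def vec_eq_iff matrix_vector_mult_add_rdistrib inner_add_right)

lemma rank_scaleR:
  fixes A :: "real^'n^'m"
  assumes "c \<noteq> 0"
  shows "rank (c *\<^sub>R A) = rank A"
proof -
  have "range ((*v) (c *\<^sub>R A)) = range ((*v) A)"
  proof (intro equalityI image_subsetI)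
    fix x
    show "(c *\<^sub>R A) *v x \<in> range ((*v) A)"
      by (metis matrix_vector_mult_scaleR rangeI scaleR_matrix_vector_assoc)
    have "A *v x = (c *\<^sub>R A) *v (inverse c *\<^sub>R x)"
      using assms by (simp add: matrix_vector_mult_scaleR flip: scaleR_matrix_vector_assoc)
    then show "A *v x \<in> range ((*v) (c *\<^sub>R A))"
      by blast
  qed
  then show ?thesis
    by (simp add: rank_dim_range)
qed

section \<open>Passing between decompositions and Hessian majorants\<close>

lemma dc2_dominated_by_projection:
  fixes X :: "(real^'n) set"
  assumes X: "compact X" "affine hull X = UNIV" and gh: "(g, h) \<in> dc2 f X"
  shows "\<exists>B\<in>hess_majorants f X. rank B = curv_dim X g"
proof -
  let ?K = "convex hull X"
  from gh obtain U where U: "?K \<subseteq> U" "open U" "C2_on g U" "C2_on h U"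
      "\<And>x. x \<in> U \<Longrightarrow> f x = g x - h x" and cvx: "convex_on ?K g" "convex_on ?K h"
    by (auto simp: dc2_def)
  have K: "compact ?K"
    using X by (simp add: compact_convex_hull)
  \<comment> \<open>Full dimension enters here: it gives the hull an interior, which is what lets
    convexity of \<open>h\<close> force a positive semidefinite Hessian on the whole hull.\<close>
  have "affine hull ?K = UNIV"
    using X by (simp add: affine_hull_convex_hull)
  moreover have "?K \<noteq> {}"
    using X by auto
  ultimately have int: "interior ?K \<noteq> {}"
    by (metis convex_convex_hull rel_interior_eq_empty rel_interior_interior)
  obtain c where c: "c > 0" "\<And>z v. z \<in> ?K \<Longrightarrow> norm (hessian g z *v v) \<le> c * norm v"
    using hessian_bounded_on_compact[OF U(3) K U(1)] by blast
  let ?V = "curv_space X g"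
  obtain P :: "real^'n^'n" where P: "transpose P = P" "range ((*v) P) = ?V"
      "\<And>x. x \<in> ?V \<Longrightarrow> P *v x = x"
    using orthogonal_projection_matrix[of ?V] by (auto simp: curv_space_def)
  have dom: "psd (c *\<^sub>R P - hessian g z)" if "z \<in> ?K" for z
  proof (rule psd_scaled_projection_diff[OF P])
    show "transpose (hessian g z) = hessian g z"
      using hessian_symmetric[OF U(3)] U(1) that by blast
    show "range ((*v) (hessian g z)) \<subseteq> ?V"
      using that unfolding curv_space_def by (auto intro: span_base)
  qed (use c that in auto)
  \<comment> \<open>The domination estimate with zero in place of the Hessian shows that
    \<open>c *\<^sub>R P\<close> itself is positive semidefinite.\<close>
  have "psd (c *\<^sub>R P - 0)"
    by (rule psd_scaled_projection_diff[OF P])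
      (use c in \<open>auto simp: transpose_def vec_eq_iff curv_space_def span_zero\<close>)
  moreover have "c *\<^sub>R P - hessian f z \<succeq> 0" if "z \<in> ?K" for z
  proof -
    have "hessian f z = hessian g z - hessian h z"
      using C2_on_diff(2)[OF U(3,4) U(2) subset_refl U(5)] U(1) that by blast
    then have "c *\<^sub>R P - hessian f z = (c *\<^sub>R P - hessian g z) + hessian h z"
      by simp
    moreover have "psd (hessian h z)"
      by (rule convex_on_imp_hessian_psd[OF U(4) cvx(2) U(1) int that])
    ultimately show ?thesis
      using psd_add[OF dom[OF that]] unfolding loewner_ge_def diff_zero by metis
  qed
  moreover have "rank (c *\<^sub>R P) = curv_dim X g"
    using c(1) rank_scaleR[of c P] by (simp add: rank_dim_range[of P] P(2) curv_dim_def)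
  ultimately show ?thesis
    unfolding hess_majorants_def by auto
qed

text \<open>The two conditions on a majorant are the second-order convexity tests for the two
  components, whose Hessians are \<open>B\<close> and \<open>B - hessian f z\<close>.\<close>

lemma quad_majorant_dc2:
  fixes X :: "(real^'n) set"
  assumes U: "open U" "convex hull X \<subseteq> U" "C2_on f U" and B: "B \<in> hess_majorants f X"
  shows "(quad B, \<lambda>x. quad B x - f x) \<in> dc2 f X"
proof -
  let ?h = "\<lambda>x. quad B x - f x"
  have psd: "psd B" "\<And>z. z \<in> convex hull X \<Longrightarrow> psd (B - hessian f z)"
    using B by (auto simp: hess_majorants_def loewner_ge_def)
  have sym: "transpose B = B"
    using psd by (simp add: psd_def)
  have q: "C2_on (quad B) U"
    using C2_on_quad(1)[OF sym] U(1)
    by (auto simp: C2_on_def elim: differentiable_on_subset continuous_on_subset)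
  note h = C2_on_diff[OF q U(3) U(1) subset_refl, of ?h, OF refl]
  have "convex_on (convex hull X) (quad B)"
    using psd by (intro hessian_psd_imp_convex_on[OF q _ U(2)]) (auto simp: C2_on_quad(2)[OF sym])
  moreover have "convex_on (convex hull X) ?h"
    using psd U(2) by (intro hessian_psd_imp_convex_on[OF h(1) _ U(2)])
      (auto simp: C2_on_quad(2)[OF sym] h(2) subset_iff)
  ultimately show ?thesis
    unfolding dc2_def using U q h(1) by (auto intro!: exI[of _ U])
qed

text \<open>With a constant Hessian the union of ranges collapses to the range of \<open>B\<close>.
  For empty \<open>X\<close> the union would be empty and the dimension 0.\<close>

lemma curv_dim_quad:
  assumes "psd B" "X \<noteq> {}"
  shows "curv_dim X (quad B) = rank B"
proof -
  have sym: "transpose B = B"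
    using assms by (simp add: psd_def)
  show ?thesis
    using assms(2) unfolding curv_dim_def curv_space_def C2_on_quad(2)[OF sym] rank_dim_range
    by (simp add: dim_span)
qed

text \<open>A large multiple of the identity works: it is the projection estimate for the whole
  space.\<close>

lemma hess_majorants_nonempty:
  fixes X :: "(real^'n) set"
  assumes X: "compact X" and U: "convex hull X \<subseteq> U" "C2_on f U"
  shows "hess_majorants f X \<noteq> {}"
proof -
  obtain c where c: "c > 0" "\<And>z v. z \<in> convex hull X \<Longrightarrow> norm (hessian f z *v v) \<le> c * norm v"
    using hessian_bounded_on_compact[OF U(2) compact_convex_hull[OF X] U(1)] by blast
  have one: "range ((*v) (mat 1 :: real^'n^'n)) = UNIV"
    by auto
  have "transpose (0 :: real^'n^'n) = 0"
    by (simp add: transpose_def vec_eq_iff)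
  then have "psd (c *\<^sub>R mat 1 - (0 :: real^'n^'n))"
    by (intro psd_scaled_projection_diff[OF _ one]) (use c in auto)
  moreover have "psd (c *\<^sub>R mat 1 - hessian f z)" if "z \<in> convex hull X" for z
    by (rule psd_scaled_projection_diff[OF _ one])
      (use c that hessian_symmetric[OF U(2)] U(1) in auto)
  ultimately have "c *\<^sub>R mat 1 \<in> hess_majorants f X"
    by (simp add: hess_majorants_def loewner_ge_def)
  then show ?thesis
    by blast
qed

text \<open>Nonemptiness is part of the conclusion so that \<open>LEAST\<close> denotes an attained
  minimum of ranks.\<close>

theorem theorem3p1:
  fixes X :: "(real^'n) set" and f :: "real^'n \<Rightarrow> real" and U :: "(real^'n) set"
  assumes "compact X" and "affine hull X = UNIV"
    and "open U" and "convex hull X \<subseteq> U" and "C2_on f U"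
  shows "hess_majorants f X \<noteq> {}
    \<and> opt_curv_dim f X = (LEAST r. \<exists>B\<in>hess_majorants f X. rank B = r)
    \<and> (\<exists>B\<in>hess_majorants f X.
          (quad B, \<lambda>x. quad B x - f x) \<in> dc2 f X \<and> curv_dim X (quad B) = opt_curv_dim f X)"
proof -
  have ne: "hess_majorants f X \<noteq> {}"
    by (rule hess_majorants_nonempty[OF assms(1,4,5)])
  have "X \<noteq> {}"
    using assms(2) by auto
  then have cd: "curv_dim X (quad B) = rank B" if "B \<in> hess_majorants f X" for B
    using that by (intro curv_dim_quad) (auto simp: hess_majorants_def)
  note dc = quad_majorant_dc2[OF assms(3,4,5)]
  \<comment> \<open>The sets of attained values coincide, so their least elements do, with no
    separate inequalities between minima.\<close>
  have "(\<exists>(g, h)\<in>dc2 f X. curv_dim X g = r) \<longleftrightarrow> (\<exists>B\<in>hess_majorants f X. rank B = r)" for r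
    using dc2_dominated_by_projection[OF assms(1,2)] dc cd by fast
  then have opt: "opt_curv_dim f X = (LEAST r. \<exists>B\<in>hess_majorants f X. rank B = r)"
    by (simp add: opt_curv_dim_def)
  obtain B\<^sub>0 where "B\<^sub>0 \<in> hess_majorants f X"
    using ne by blast
  then have "\<exists>B\<in>hess_majorants f X. rank B = rank B\<^sub>0"
    by blast
  then have "\<exists>B\<in>hess_majorants f X. rank B = opt_curv_dim f X"
    unfolding opt by (rule LeastI)
  then obtain B where B: "B \<in> hess_majorants f X" "rank B = opt_curv_dim f X"
    by blast
  then have "(quad B, \<lambda>x. quad B x - f x) \<in> dc2 f X" "curv_dim X (quad B) = opt_curv_dim f X"
    using dc[OF B(1)] cd[OF B(1)] by simp_all
  then show ?thesis
    using ne opt B(1) by blast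
qed

end
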